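(* Let $k$ be a local field. Then for any Banach $k$-vector space $V$, the following are equivalent: (1) $V$ is free. (2) $V$ is almost free, and, if $\dim_k V=1$, $V$ is isomorphic to $k$ (by an isometric $k$-linear isomorphism). (3) $\|V\|\subset|k|$, where $\|V\|=\{\|v\|:v\in V\}$ and $|k|=\{|c|:c\in k\}$.
   Context: A complete valuation field is a field $k$ with a map $|\cdot|:k\to\mathbb{R}_{\ge 0}$ such that $|c|=0$ iff $c=0$, $|c_0-c_1|\le\max\{|c_0|,|c_1|\}$, $|c_0c_1|=|c_0||c_1|$, and $k$ is complete for the ultrametric $|c_0-c_1|$. A local field is a complete valuation field $k$ whose valuation is discrete, i.e. $|k^\times|$ is a free subgroup of rank $1$ of the multiplicative group $\mathbb{R}_{>0}$, and such that the residue field of the valuation ring $O_k=\{c\in k:|c|\le 1\}$ is finite. A Banach $k$-vector space is a $k$-vector space $V$ with a map $\|\cdot\|:V\to\mathbb{R}_{\ge 0}$ such that $\|v\|=0$ iff $v=0$, $\|v_0-v_1\|\le\max\{\|v_0\|,\|v_1\|\}$, $\|cv\|=|c|\|v\|$, and $V$ is complete for the ultrametric $\|v_0-v_1\|$. Closed $k$-linear subspaces carry the restricted norm and are Banach $k$-vector spaces. For a set $E$, $C_0(E,k)$ is the Banach $k$-vector space of maps $c:E\to k$ such that $\{e\in E:|c(e)|\ge\epsilon\}$ is finite for every $\epsilon>0$, with the norm $\|c\|=\sup_{e\in E}|c(e)|$ (equal to $0$ if $E=\emptyset$). An orthonormal Schauder basis of $V$ is a subset $E\subset V$ such that $\|e\|=1$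 for all $e\in E$; $\|\sum_{e\in E}c(e)e\|=\|c\|$ for all $c\in C_0(E,k)$; and every $v\in V$ equals $\sum_{e\in E}c(e)e$ for some $c\in C_0(E,k)$ (the sums being the usual limits of finite sums). For $S\subset V$, $\langle S\rangle$ is the closure of the $k$-linear span of $S$. $\mathrm{rank}(V)$ is the minimum cardinality of a subset $S\subset V$ with $V=\langle S\rangle$. $V$ is free if it admits an orthonormal Schauder basis; for a cardinal $\kappa$, $V$ is $\kappa$-free if every closed subspace of the form $\langle S\rangle$ with $S\subset V$ of cardinality $<\kappa$ is free; $V$ is almost free if it is $\mathrm{rank}(V)$-free. *)

theory Defs
  imports "HOL-Analysis.Analysis"
begin

unbundle cardinal_syntax

text \<open>
  The library's \<^const>\<open>norm\<close> is tied to norms over the reals, so the ultrametric norm is a new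
  constant. By \<^class>\<open>complete_space\<close>, the topology and completeness are those of
  the metric \<open>dist v w = ultranorm (v - w)\<close>.
\<close>

class ultrametric_banach_group = ab_group_add + complete_space +
  fixes ultranorm :: "'a \<Rightarrow> real"
  assumes dist_ultranorm: "dist v w = ultranorm (v - w)"
    and ultranorm_nonneg: "0 \<le> ultranorm v"
    and ultranorm_eq_0_iff: "ultranorm v = 0 \<longleftrightarrow> v = 0"
    and ultranorm_diff_le_max: "ultranorm (v - w) \<le> max (ultranorm v) (ultranorm w)"

class complete_valuation_field = field + ultrametric_banach_group +
  assumes valuation_mult: "ultranorm (c * d) = ultranorm c * ultranorm d"

context complete_valuation_field
begin

definition valuation_ring :: "'a set" where
  "valuation_ring = {c. ultranorm c \<le> 1}"

text \<open>The underlying set of the quotient of the valuation ring by its maximal ideal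
  \<open>{c. ultranorm c < 1}\<close>.\<close>

definition residue_field :: "'a set set" where
  "residue_field =
     valuation_ring // {(c, d) \<in> valuation_ring \<times> valuation_ring. ultranorm (c - d) < 1}"

end

text \<open>Discreteness says that for some positive real \<open>r\<close> the homomorphism \<open>n \<mapsto> r powi n\<close> from the
  integers is an isomorphism onto the value group, i.e. the value group is free of rank one.\<close>

class local_field = complete_valuation_field +
  assumes discrete_valuation:
      "\<exists>r>0. bij_betw (\<lambda>n::int. r powi n) UNIV {ultranorm c |c::'a. c \<noteq> 0}"
    and finite_residue_field: "finite residue_field"

definition C0 :: "'e set \<Rightarrow> ('e \<Rightarrow> 'k::complete_valuation_field) set" where
  "C0 E = {c \<in> E \<rightarrow>\<^sub>E UNIV. \<forall>\<epsilon>>0. finite {e \<in> E. ultranorm (c e) \<ge> \<epsilon>}}"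

definition C0_norm :: "'e set \<Rightarrow> ('e \<Rightarrow> 'k::complete_valuation_field) \<Rightarrow> real" where
  "C0_norm E c = (if E = {} then 0 else (SUP e\<in>E. ultranorm (c e)))"

locale banach_vector_space = vector_space scale
  for scale :: "'k::complete_valuation_field \<Rightarrow> 'v::ultrametric_banach_group \<Rightarrow> 'v" +
  assumes norm_scale: "ultranorm (scale c v) = ultranorm c * ultranorm v"
begin

definition closed_span :: "'v set \<Rightarrow> 'v set" where
  "closed_span S = closure (span S)"

text \<open>The predicates below refer to a closed subspace \<open>W\<close> of the whole space, regarded as
  a Banach space with the restricted norm; the space itself is the case \<open>W = UNIV\<close>.\<close>

definition orthonormal_schauder_basis :: "'v set \<Rightarrow> 'v set \<Rightarrow> bool" where
  "orthonormal_schauder_basis W E \<longleftrightarrow>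
     E \<subseteq> W \<and>
     (\<forall>e\<in>E. ultranorm e = 1) \<and>
     (\<forall>c\<in>C0 E. \<exists>s. ((\<lambda>e. scale (c e) e) has_sum s) E \<and> ultranorm s = C0_norm E c) \<and>
     (\<forall>v\<in>W. \<exists>c\<in>C0 E. ((\<lambda>e. scale (c e) e) has_sum v) E)"

definition free :: "'v set \<Rightarrow> bool" where
  "free W \<longleftrightarrow> (\<exists>E. orthonormal_schauder_basis W E)"

text \<open>A cardinal representing the minimum; it is determined up to \<open>=o\<close>.\<close>

definition rank :: "'v rel" where
  "rank = (SOME \<kappa>. \<exists>S. \<kappa> = |S| \<and> closed_span S = UNIV \<and>
             (\<forall>T. closed_span T = UNIV \<longrightarrow> |S| \<le>o |T| ))"

lemma rank_attained:
  obtains S where "rank = |S|" "closed_span S = UNIV"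
    "\<And>T. closed_span T = UNIV \<Longrightarrow> |S| \<le>o |T|"
proof -
  let ?R = "card_of ` {S. closed_span S = UNIV}"
  have "closed_span UNIV = UNIV"
    by (simp add: closed_span_def)
  then have "?R \<noteq> {}"
    by (metis (mono_tags) empty_iff imageI mem_Collect_eq)
  moreover have "\<forall>r\<in>?R. Card_order r"
    by (simp add: card_of_Card_order)
  ultimately have "\<exists>r\<in>?R. \<forall>r'\<in>?R. r \<le>o r'"
    by (rule exists_minim_Card_order)
  then obtain S where "closed_span S = UNIV" "\<forall>T. closed_span T = UNIV \<longrightarrow> |S| \<le>o |T|"
    by (simp only: bex_simps ball_simps mem_Collect_eq) iprover
  then have "\<exists>\<kappa> S. \<kappa> = |S| \<and> closed_span S = UNIV \<and>
      (\<forall>T. closed_span T = UNIV \<longrightarrow> |S| \<le>o |T| )"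
    by iprover
  then have "\<exists>S. rank = |S| \<and> closed_span S = UNIV \<and>
      (\<forall>T. closed_span T = UNIV \<longrightarrow> |S| \<le>o |T| )"
    unfolding rank_def by (rule someI_ex)
  then show thesis
    using that by iprover
qed

definition kappa_free :: "'c rel \<Rightarrow> bool" where
  "kappa_free \<kappa> \<longleftrightarrow> (\<forall>S. |S| <o \<kappa> \<longrightarrow> free (closed_span S))"

definition almost_free :: bool where
  "almost_free \<longleftrightarrow> kappa_free rank"

end

end

theory Submission
  imports Defs
begin

text \<open>
  The core is that a closed subspace \<open>W\<close> whose norms are valuations of scalars is free. By Zorn's
  lemma \<open>W\<close> has a maximal orthonormal subset \<open>E\<close>. If some \<open>v \<in> W\<close> were outside the closed span of
  \<open>E\<close>, then the distances from \<open>v\<close> to the points of the span would be valuations bounded away from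
  \<open>0\<close>; as the valuation is discrete, a least one \<open>\<parallel>v - d\<parallel> = \<bar>b\<bar>\<close> would exist, and the unit vector
  \<open>b\<^sup>-\<^sup>1 (v - d)\<close>, at distance \<open>1\<close> from the span, could be added to \<open>E\<close>
  (\<open>orthonormal_insert\<close>, \<open>free_if_norms_in_valuations\<close>). By completeness of the space and of the scalars, an orthonormal
  set is an orthonormal Schauder basis of its closed span (\<open>orthonormal_imp_schauder_basis\<close>).

  Conversely, the supremum of the valuations of a nonempty null family is attained, so norms in a
  free space are valuations (\<open>free_norms_in_valuations\<close>). If all norms are valuations, the same holds
  in every closed subspace, so all closed subspaces are free and the space is almost free; in
  dimension \<open>1\<close> there is then a unit vector, hence an isometry with the scalars
  (\<open>isometry_if_dim_1\<close>). Finally, in an almost free space of rank greater than \<open>1\<close>, every line is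
  spanned by fewer vectors than the rank, hence free, and all norms are valuations. Since lines are
  closed, a space of rank at most \<open>1\<close> is zero or of dimension \<open>1\<close>, where the isometry applies
  (\<open>almost_free_norms_in_valuations\<close>).
\<close>

section \<open>Ultrametric norms\<close>

lemma ultranorm_zero [simp]: "ultranorm (0::'a::ultrametric_banach_group) = 0"
  by (simp add: ultranorm_eq_0_iff)

lemma ultranorm_minus [simp]:
  fixes v :: "'a::ultrametric_banach_group"
  shows "ultranorm (- v) = ultranorm v"
proof -
  have "ultranorm (- x) \<le> ultranorm x" for x :: 'a
    using ultranorm_diff_le_max[of 0 x] ultranorm_nonneg[of x] by simp
  from this[of v] this[of "- v"] show ?thesis by simp
qed

lemma ultranorm_add_le_max:
  fixes v w :: "'a::ultrametric_banach_group"
  shows "ultranorm (v + w) \<le> max (ultranorm v) (ultranorm w)"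
  using ultranorm_diff_le_max[of v "- w"] by simp

lemma ultranorm_sum_le:
  fixes f :: "'b \<Rightarrow> 'a::ultrametric_banach_group"
  assumes "0 \<le> B" "\<And>x. x \<in> F \<Longrightarrow> ultranorm (f x) \<le> B"
  shows "ultranorm (sum f F) \<le> B"
  using assms(2)
proof (induction F rule: infinite_finite_induct)
  case (insert x F)
  have "ultranorm (f x + sum f F) \<le> max (ultranorm (f x)) (ultranorm (sum f F))"
    by (rule ultranorm_add_le_max)
  also have "\<dots> \<le> B" using insert by simp
  finally show ?case using insert by simp
qed (use assms(1) in auto)

lemma abs_ultranorm_diff_le:
  fixes v w :: "'a::ultrametric_banach_group"
  shows "\<bar>ultranorm v - ultranorm w\<bar> \<le> dist v w"
proof -
  have "ultranorm x \<le> ultranorm (x - y) + ultranorm y" for x y :: 'a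
    using ultranorm_add_le_max[of "x - y" y] ultranorm_nonneg[of y] ultranorm_nonneg[of "x - y"]
    by simp
  from this[of v w] this[of w v] show ?thesis
    using dist_commute[of v w] by (simp add: dist_ultranorm)
qed

lemma tendsto_ultranorm:
  fixes f :: "'b \<Rightarrow> 'a::ultrametric_banach_group"
  assumes "(f \<longlongrightarrow> l) F"
  shows "((\<lambda>x. ultranorm (f x)) \<longlongrightarrow> ultranorm l) F"
proof (rule tendstoI)
  fix e :: real assume "0 < e"
  with assms have "\<forall>\<^sub>F x in F. dist (f x) l < e" by (rule tendstoD)
  then show "\<forall>\<^sub>F x in F. dist (ultranorm (f x)) (ultranorm l) < e"
    by eventually_elim (simp add: dist_real_def le_less_trans[OF abs_ultranorm_diff_le])
qed

instance ultrametric_banach_group \<subseteq> topological_ab_group_add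
proof
  fix a b :: 'a
  have "((\<lambda>x. dist (fst x) a + dist (snd x) b) \<longlongrightarrow> 0) (nhds a \<times>\<^sub>F nhds b)"
    by (intro tendsto_add_zero tendsto_dist_iff[THEN iffD1] filterlim_fst filterlim_snd)
  moreover have "dist (v + w) (a + b) \<le> dist v a + dist w b" for v w
    using ultranorm_add_le_max[of "v - a" "w - b"]
      ultranorm_nonneg[of "v - a"] ultranorm_nonneg[of "w - b"]
    by (simp add: dist_ultranorm add_diff_add)
  ultimately have "((\<lambda>x. dist (fst x + snd x) (a + b)) \<longlongrightarrow> 0) (nhds a \<times>\<^sub>F nhds b)"
    by (elim tendsto_0_le[where K = 1]) simp
  then show "((\<lambda>x. fst x + snd x) \<longlongrightarrow> a + b) (nhds a \<times>\<^sub>F nhds b)"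
    by (rule tendsto_dist_iff[THEN iffD2])
  have "dist (- v) (- a) = dist v a" for v
    using ultranorm_minus[of "v - a"] by (simp add: dist_ultranorm)
  then have "((\<lambda>v. dist (- v) (- a)) \<longlongrightarrow> 0) (nhds a)"
    using tendsto_dist_iff[THEN iffD1, OF filterlim_ident[of "nhds a"]] by simp
  then show "(uminus \<longlongrightarrow> - a) (nhds a)"
    by (rule tendsto_dist_iff[THEN iffD2])
qed

lemma ultranorm_one [simp]: "ultranorm (1::'k::complete_valuation_field) = 1"
  using valuation_mult[of "1::'k" 1] by (simp add: ultranorm_eq_0_iff)

lemma ultranorm_inverse:
  fixes c :: "'k::complete_valuation_field"
  shows "ultranorm (inverse c) = inverse (ultranorm c)"
proof (cases "c = 0")
  case False
  then have "ultranorm (inverse c) * ultranorm c = 1"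
    by (simp flip: valuation_mult)
  then show ?thesis by (metis inverse_unique mult.commute)
qed simp

text \<open>The value group is generated by some \<open>r \<noteq> 1\<close>, and bounds on \<open>ln (r powi n) = n * ln r\<close> bound
  \<open>\<bar>n\<bar>\<close>.\<close>

lemma finite_valuations_between:
  assumes "0 < \<delta>"
  shows "finite (range (ultranorm :: 'k::local_field \<Rightarrow> real) \<inter> {\<delta>..M})"
proof -
  obtain r :: real where r: "0 < r"
    and bij: "bij_betw (\<lambda>n::int. r powi n) UNIV {ultranorm c |c::'k. c \<noteq> 0}"
    using discrete_valuation by blast
  have "r \<noteq> 1"
  proof
    assume "r = 1"
    with bij have "inj (\<lambda>n::int. 1::real)" by (simp add: bij_betw_def)
    then show False by (metis injD zero_neq_one)
  qed
  with r have lnr: "ln r \<noteq> 0" by simp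
  define B where "B = \<lceil>max \<bar>ln \<delta>\<bar> \<bar>ln M\<bar> / \<bar>ln r\<bar>\<rceil>"
  have "range (ultranorm :: 'k \<Rightarrow> real) \<inter> {\<delta>..M} \<subseteq> (\<lambda>n::int. r powi n) ` {-B..B}"
  proof
    fix x assume x: "x \<in> range (ultranorm :: 'k \<Rightarrow> real) \<inter> {\<delta>..M}"
    then obtain c :: 'k where c: "x = ultranorm c" by blast
    with x assms have "c \<noteq> 0" by auto
    with c have "x \<in> {ultranorm c |c::'k. c \<noteq> 0}" by blast
    with bij obtain n :: int where n: "x = r powi n"
      unfolding bij_betw_def by blast
    have "ln x = of_int n * ln r"
      unfolding n using r by (simp add: power_int_def ln_realpow ln_inverse)
    then have "\<bar>of_int n\<bar> * \<bar>ln r\<bar> = \<bar>ln x\<bar>" by (simp only: abs_mult)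
    also have "\<bar>ln x\<bar> \<le> max \<bar>ln \<delta>\<bar> \<bar>ln M\<bar>"
    proof -
      have "ln \<delta> \<le> ln x" "ln x \<le> ln M" using x assms by auto
      then show ?thesis by linarith
    qed
    finally have "\<bar>of_int n\<bar> * \<bar>ln r\<bar> \<le> max \<bar>ln \<delta>\<bar> \<bar>ln M\<bar>" .
    then have "of_int \<bar>n\<bar> \<le> max \<bar>ln \<delta>\<bar> \<bar>ln M\<bar> / \<bar>ln r\<bar>"
      using lnr by (simp add: pos_le_divide_eq)
    then have "\<bar>n\<bar> \<le> B" unfolding B_def by linarith
    then show "x \<in> (\<lambda>n::int. r powi n) ` {-B..B}" using n by (intro image_eqI[of _ _ n]) auto
  qed
  then show ?thesis by (rule finite_subset) simp
qed

section \<open>The space of null families\<close>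

lemma C0_norm_attained:
  assumes c: "c \<in> C0 E" and E: "E \<noteq> {}"
  obtains e\<^sub>0 where "e\<^sub>0 \<in> E" "\<And>e. e \<in> E \<Longrightarrow> ultranorm (c e) \<le> ultranorm (c e\<^sub>0)"
    "C0_norm E c = ultranorm (c e\<^sub>0)"
proof -
  have "\<exists>e\<^sub>0\<in>E. \<forall>e\<in>E. ultranorm (c e) \<le> ultranorm (c e\<^sub>0)"
  proof (cases "\<forall>e\<in>E. ultranorm (c e) = 0")
    case True
    then show ?thesis using E by auto
  next
    case False
    then obtain e\<^sub>1 where e1: "e\<^sub>1 \<in> E" "ultranorm (c e\<^sub>1) \<noteq> 0" by blast
    then have pos: "0 < ultranorm (c e\<^sub>1)" using ultranorm_nonneg[of "c e\<^sub>1"] by simp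
    let ?L = "{e \<in> E. ultranorm (c e) \<ge> ultranorm (c e\<^sub>1)}"
    have L: "finite ?L" "e\<^sub>1 \<in> ?L" using c pos e1 unfolding C0_def by auto
    let ?M = "Max ((\<lambda>e. ultranorm (c e)) ` ?L)"
    have "?M \<in> (\<lambda>e. ultranorm (c e)) ` ?L" using L by (intro Max_in) auto
    then obtain e\<^sub>0 where e0: "e\<^sub>0 \<in> ?L" "ultranorm (c e\<^sub>0) = ?M" by auto
    have le: "ultranorm (c e) \<le> ultranorm (c e\<^sub>0)" if "e \<in> ?L" for e
      unfolding e0(2) using L(1) that by (intro Max_ge) auto
    have "ultranorm (c e) \<le> ultranorm (c e\<^sub>0)" if "e \<in> E" for e
      using e0(1) le[of e] that by (cases "e \<in> ?L") auto
    then show ?thesis using e0(1) by blast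
  qed
  then obtain e\<^sub>0 where e0: "e\<^sub>0 \<in> E" "\<And>e. e \<in> E \<Longrightarrow> ultranorm (c e) \<le> ultranorm (c e\<^sub>0)"
    by blast
  then have "(SUP e\<in>E. ultranorm (c e)) = ultranorm (c e\<^sub>0)"
    by (intro cSup_eq_maximum) auto
  with e0 E that show thesis by (simp add: C0_norm_def)
qed

lemma C0_norm_in_range_valuation:
  fixes c :: "'e \<Rightarrow> 'k::complete_valuation_field"
  assumes "c \<in> C0 E"
  shows "C0_norm E c \<in> range (ultranorm :: 'k \<Rightarrow> real)"
proof (cases "E = {}")
  case True
  then show ?thesis using rangeI[of ultranorm "0::'k"] by (simp add: C0_norm_def)
next
  case False
  then show ?thesis using C0_norm_attained[OF assms] by (metis rangeI)
qed

section \<open>Orthonormal sets\<close>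

context banach_vector_space
begin

text \<open>A set of unit vectors is orthonormal if no coefficient of a finite linear combination exceeds
  the norm of the combination; by the ultrametric inequality this norm is then the maximum of the
  valuations of the coefficients.\<close>

definition orthonormal :: "'v set \<Rightarrow> bool" where
  "orthonormal E \<longleftrightarrow> (\<forall>e\<in>E. ultranorm e = 1) \<and>
     (\<forall>F a. finite F \<longrightarrow> F \<subseteq> E \<longrightarrow>
        (\<forall>e\<in>F. ultranorm (a e) \<le> ultranorm (\<Sum>x\<in>F. scale (a x) x)))"

lemma orthonormal_unit: "orthonormal E \<Longrightarrow> e \<in> E \<Longrightarrow> ultranorm e = 1"
  by (simp add: orthonormal_def)

lemma orthonormal_coeff_le:
  "orthonormal E \<Longrightarrow> finite F \<Longrightarrow> F \<subseteq> E \<Longrightarrow> e \<in> F \<Longrightarrow>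
     ultranorm (a e) \<le> ultranorm (\<Sum>x\<in>F. scale (a x) x)"
  by (simp add: orthonormal_def)

lemma orthonormal_sum_le:
  assumes "orthonormal E" "F \<subseteq> E" "0 \<le> B" "\<And>e. e \<in> F \<Longrightarrow> ultranorm (a e) \<le> B"
  shows "ultranorm (\<Sum>x\<in>F. scale (a x) x) \<le> B"
  using assms by (intro ultranorm_sum_le) (auto simp: norm_scale orthonormal_unit subset_iff)

lemma orthonormal_independent:
  assumes "orthonormal E"
  shows "independent E"
  unfolding independent_explicit_module
proof (intro allI impI)
  fix F a e
  assume "finite F" "F \<subseteq> E" and sum: "(\<Sum>v\<in>F. scale (a v) v) = 0" and "e \<in> F"
  then have "ultranorm (a e) \<le> 0"
    using orthonormal_coeff_le[OF assms, of F e a] by simp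
  then show "a e = 0"
    using ultranorm_nonneg[of "a e"] by (simp flip: ultranorm_eq_0_iff)
qed

lemma orthonormal_representation_le:
  assumes E: "orthonormal E" and x: "x \<in> span E"
  shows "ultranorm (representation E x e) \<le> ultranorm x"
proof (cases "representation E x e = 0")
  case True
  then show ?thesis by (simp add: ultranorm_nonneg)
next
  case False
  let ?F = "{b. representation E x b \<noteq> 0}"
  have "x = (\<Sum>b\<in>?F. scale (representation E x b) b)"
    using sum_nonzero_representation_eq[OF orthonormal_independent[OF E] x] by simp
  moreover have "ultranorm (representation E x e) \<le> ultranorm (\<Sum>b\<in>?F. scale (representation E x b) b)"
    using False by (intro orthonormal_coeff_le[OF E])
      (auto simp: finite_representation intro: representation_ne_zero)
  ultimately show ?thesis by simp
qed

text \<open>The net of finite partial sums of a null family is Cauchy: beyond the finite set of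
  coefficients of valuation at least \<open>\<epsilon>\<close>, it varies by less than \<open>\<epsilon>\<close>.\<close>

lemma orthonormal_summable:
  assumes E: "orthonormal E" and c: "c \<in> C0 E"
  obtains s where "((\<lambda>e. scale (c e) e) has_sum s) E"
proof -
  define f where "f = (\<lambda>e. scale (c e) e)"
  define L where "L n = {e \<in> E. inverse (real (Suc n)) \<le> ultranorm (c e)}" for n
  have L: "finite (L n)" "L n \<subseteq> E" for n
    using c unfolding C0_def L_def by auto
  have close: "dist (sum f F) (sum f (L n)) \<le> inverse (real (Suc n))"
    if "finite F" "F \<subseteq> E" "L n \<subseteq> F" for F n
  proof -
    have "sum f F - sum f (L n) = sum f (F - L n)"
      using that by (simp add: sum_diff)
    moreover have "ultranorm (sum f (F - L n)) \<le> inverse (real (Suc n))"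
      unfolding f_def using that
      by (intro orthonormal_sum_le[OF E]) (auto simp: L_def)
    ultimately show ?thesis by (simp add: dist_ultranorm)
  qed
  have L_mono: "L m \<subseteq> L n" if "m \<le> n" for m n
  proof -
    have "inverse (real (Suc n)) \<le> inverse (real (Suc m))" using that by (simp add: field_simps)
    then show ?thesis unfolding L_def using order_trans by blast
  qed
  have "Cauchy (\<lambda>n. sum f (L n))"
  proof (rule metric_CauchyI)
    fix \<epsilon> :: real assume "0 < \<epsilon>"
    then obtain N where N: "inverse (real (Suc N)) < \<epsilon> / 2"
      using reals_Archimedean[of "\<epsilon> / 2"] by auto
    show "\<exists>M. \<forall>m\<ge>M. \<forall>n\<ge>M. dist (sum f (L m)) (sum f (L n)) < \<epsilon>"
    proof (intro exI allI impI)
      fix m n assume "N \<le> m" "N \<le> n"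
      then have "dist (sum f (L m)) (sum f (L N)) < \<epsilon> / 2" "dist (sum f (L n)) (sum f (L N)) < \<epsilon> / 2"
        using close[OF L(1,2) L_mono] N by (meson le_less_trans)+
      then show "dist (sum f (L m)) (sum f (L n)) < \<epsilon>" by (rule dist_triangle_half_l)
    qed
  qed
  then obtain s where s: "(\<lambda>n. sum f (L n)) \<longlonglongrightarrow> s"
    by (metis Cauchy_convergent convergent_def)
  have "(f has_sum s) E"
    unfolding has_sum_def
  proof (rule tendstoI)
    fix \<epsilon> :: real assume e: "0 < \<epsilon>"
    then obtain N where N: "inverse (real (Suc N)) < \<epsilon> / 2"
      using reals_Archimedean[of "\<epsilon> / 2"] by auto
    from e s have "\<forall>\<^sub>F n in sequentially. dist (sum f (L n)) s < \<epsilon> / 2"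
      by (intro tendstoD) auto
    then obtain n where n: "N \<le> n" "dist (sum f (L n)) s < \<epsilon> / 2"
      unfolding eventually_sequentially by (meson linear)
    have "inverse (real (Suc n)) \<le> inverse (real (Suc N))" using n(1) by (simp add: field_simps)
    with N have n': "inverse (real (Suc n)) < \<epsilon> / 2" by (rule le_less_trans[rotated])
    show "\<forall>\<^sub>F F in finite_subsets_at_top E. dist (sum f F) s < \<epsilon>"
      unfolding eventually_finite_subsets_at_top
    proof (intro exI[of _ "L n"] conjI allI impI)
      fix F assume F: "finite F \<and> L n \<subseteq> F \<and> F \<subseteq> E"
      then have "dist (sum f F) (sum f (L n)) < \<epsilon> / 2" using close[of F n] n' by simp
      then show "dist (sum f F) s < \<epsilon>" using n(2) dist_triangle[of "sum f F" s "sum f (L n)"] by simp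
    qed (use L in auto)
  qed
  then show thesis using that unfolding f_def by blast
qed

lemma orthonormal_ultranorm_has_sum:
  assumes E: "orthonormal E" and c: "c \<in> C0 E" and s: "((\<lambda>e. scale (c e) e) has_sum s) E"
  shows "ultranorm s = C0_norm E c"
proof (cases "E = {}")
  case True
  with s have "s = 0" using has_sum_unique[OF _ has_sum_empty] by blast
  with True show ?thesis by (simp add: C0_norm_def)
next
  case False
  then obtain e\<^sub>0 where e0: "e\<^sub>0 \<in> E" "\<And>e. e \<in> E \<Longrightarrow> ultranorm (c e) \<le> ultranorm (c e\<^sub>0)"
    "C0_norm E c = ultranorm (c e\<^sub>0)"
    using C0_norm_attained[OF c] by blast
  have "ultranorm (\<Sum>e\<in>F. scale (c e) e) = C0_norm E c"
    if "finite F" "{e\<^sub>0} \<subseteq> F" "F \<subseteq> E" for F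
    unfolding e0(3) using that e0
    by (intro antisym orthonormal_sum_le[OF E] orthonormal_coeff_le[OF E]) (auto simp: ultranorm_nonneg)
  then have "\<forall>\<^sub>F F in finite_subsets_at_top E. ultranorm (\<Sum>e\<in>F. scale (c e) e) = C0_norm E c"
    unfolding eventually_finite_subsets_at_top
    using e0(1) by (intro exI[of _ "{e\<^sub>0}"]) auto
  then have "((\<lambda>F. ultranorm (\<Sum>e\<in>F. scale (c e) e)) \<longlongrightarrow> C0_norm E c) (finite_subsets_at_top E)"
    by (rule tendsto_eventually)
  moreover have "((\<lambda>F. ultranorm (\<Sum>e\<in>F. scale (c e) e)) \<longlongrightarrow> ultranorm s) (finite_subsets_at_top E)"
    using s unfolding has_sum_def by (rule tendsto_ultranorm)
  ultimately show ?thesis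
    using tendsto_unique finite_subsets_at_top_neq_bot by blast
qed

text \<open>The coordinates on the span of an orthonormal set do not increase the norm, so they converge
  uniformly along a sequence converging to a point of the closed span.\<close>

lemma orthonormal_expansion:
  assumes E: "orthonormal E" and v: "v \<in> closed_span E"
  obtains c where "c \<in> C0 E" "((\<lambda>e. scale (c e) e) has_sum v) E"
proof -
  obtain x where x: "\<And>n. x n \<in> span E" "x \<longlonglongrightarrow> v"
    using v unfolding closed_span_def closure_sequential by blast
  define R where "R n = representation E (x n)" for n
  have ind: "independent E" using E by (rule orthonormal_independent)
  have R_dist: "dist (R m e) (R n e) \<le> dist (x m) (x n)" for m n e
    unfolding R_def dist_ultranorm
    using orthonormal_representation_le[OF E span_diff[OF x(1) x(1)]]
      representation_diff[OF ind x(1) x(1)] by simp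
  have Cx: "Cauchy x" using x(2) by (rule LIMSEQ_imp_Cauchy)
  have "\<exists>l. (\<lambda>n. R n e) \<longlonglongrightarrow> l" for e
  proof -
    have "Cauchy (\<lambda>n. R n e)"
      using Cx R_dist unfolding Cauchy_def by (meson le_less_trans)
    then show ?thesis by (simp add: Cauchy_convergent_iff convergent_def)
  qed
  then obtain l where l: "\<And>e. (\<lambda>n. R n e) \<longlonglongrightarrow> l e" by metis
  define c where "c = restrict l E"
  have c_l: "c e = l e" if "e \<in> E" for e using that by (simp add: c_def)
  have l_close: "ultranorm (l e - R n e) \<le> \<epsilon>" if "\<forall>m\<ge>n. dist (x m) (x n) \<le> \<epsilon>" for \<epsilon> n e
  proof -
    have "(\<lambda>m. dist (R m e) (R n e)) \<longlonglongrightarrow> dist (l e) (R n e)"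
      by (intro tendsto_dist l tendsto_const)
    moreover have "\<exists>N. \<forall>m\<ge>N. dist (R m e) (R n e) \<le> \<epsilon>"
      using that R_dist by (meson order_trans)
    ultimately show ?thesis unfolding dist_ultranorm[symmetric] by (rule LIMSEQ_le_const2)
  qed
  have near: "\<exists>n. dist (x n) v \<le> \<epsilon> \<and> (\<forall>e. ultranorm (l e - R n e) \<le> \<epsilon>)" if "0 < \<epsilon>" for \<epsilon>
  proof -
    from Cx that obtain M where M: "\<And>m n. M \<le> m \<Longrightarrow> M \<le> n \<Longrightarrow> dist (x m) (x n) < \<epsilon>"
      unfolding Cauchy_def by meson
    have "\<forall>\<^sub>F n in sequentially. dist (x n) v < \<epsilon>" using x(2) that by (rule tendstoD)
    then obtain n where n: "M \<le> n" "dist (x n) v < \<epsilon>"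
      unfolding eventually_sequentially by (meson linear)
    then show ?thesis using l_close[of n \<epsilon>] M by (meson less_imp_le order_trans)
  qed
  have R_finite: "finite {e. R n e \<noteq> 0}" for n
    unfolding R_def by (rule finite_representation)
  have c: "c \<in> C0 E"
    unfolding C0_def
  proof (intro CollectI conjI allI impI)
    show "c \<in> E \<rightarrow>\<^sub>E UNIV" by (simp add: c_def)
    fix \<epsilon> :: real assume "0 < \<epsilon>"
    then obtain n where n: "\<And>e. ultranorm (l e - R n e) \<le> \<epsilon> / 2" using near[of "\<epsilon> / 2"] by auto
    have "R n e \<noteq> 0" if "e \<in> E" "\<epsilon> \<le> ultranorm (c e)" for e
    proof
      assume "R n e = 0"
      with n[of e] that c_l[of e] \<open>0 < \<epsilon>\<close> show False by simp
    qed
    then show "finite {e \<in> E. \<epsilon> \<le> ultranorm (c e)}"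
      by (intro finite_subset[OF _ R_finite[of n]]) auto
  qed
  obtain s where s: "((\<lambda>e. scale (c e) e) has_sum s) E"
    using orthonormal_summable[OF E c] .
  have "dist s v \<le> 0"
  proof (rule field_le_epsilon)
    fix \<epsilon> :: real assume "0 < \<epsilon>"
    then obtain n where n: "dist (x n) v \<le> \<epsilon> / 2" "\<And>e. ultranorm (l e - R n e) \<le> \<epsilon> / 2"
      using near[of "\<epsilon> / 2"] by auto
    let ?S = "{e. R n e \<noteq> 0}"
    have S: "?S \<subseteq> E" unfolding R_def using representation_ne_zero by blast
    have "dist (\<Sum>e\<in>F. scale (c e) e) (x n) \<le> \<epsilon> / 2" if F: "finite F" "?S \<subseteq> F" "F \<subseteq> E" for F
    proof -
      have "x n = (\<Sum>e\<in>?S. scale (R n e) e)"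
        unfolding R_def using sum_nonzero_representation_eq[OF ind x(1)] by simp
      also have "\<dots> = (\<Sum>e\<in>F. scale (R n e) e)"
        using F by (intro sum.mono_neutral_left) auto
      finally have "(\<Sum>e\<in>F. scale (c e) e) - x n = (\<Sum>e\<in>F. scale (c e - R n e) e)"
        by (simp add: sum_subtractf scale_left_diff_distrib)
      moreover have "ultranorm (\<Sum>e\<in>F. scale (c e - R n e) e) \<le> \<epsilon> / 2"
        using F n(2) \<open>0 < \<epsilon>\<close> by (intro orthonormal_sum_le[OF E]) (auto simp: c_l subset_iff)
      ultimately show ?thesis by (simp add: dist_ultranorm)
    qed
    then have ev: "\<forall>\<^sub>F F in finite_subsets_at_top E. dist (\<Sum>e\<in>F. scale (c e) e) (x n) \<le> \<epsilon> / 2"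
      unfolding eventually_finite_subsets_at_top
      using R_finite[of n] S by (intro exI[of _ ?S]) auto
    have "((\<lambda>F. dist (\<Sum>e\<in>F. scale (c e) e) (x n)) \<longlongrightarrow> dist s (x n)) (finite_subsets_at_top E)"
      using s unfolding has_sum_def by (intro tendsto_dist tendsto_const)
    then have "dist s (x n) \<le> \<epsilon> / 2"
      using ev finite_subsets_at_top_neq_bot by (rule tendsto_upperbound)
    then show "dist s v \<le> 0 + \<epsilon>" using n(1) dist_triangle[of s v "x n"] by simp
  qed
  then have "s = v" by simp
  with c s that show thesis by blast
qed

theorem orthonormal_imp_schauder_basis:
  assumes E: "orthonormal E"
  shows "orthonormal_schauder_basis (closed_span E) E"
  unfolding orthonormal_schauder_basis_def
proof (intro conjI ballI)
  show "E \<subseteq> closed_span E"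
    unfolding closed_span_def using span_superset closure_subset by blast
  show "ultranorm e = 1" if "e \<in> E" for e using E that by (rule orthonormal_unit)
  show "\<exists>s. ((\<lambda>e. scale (c e) e) has_sum s) E \<and> ultranorm s = C0_norm E c" if "c \<in> C0 E" for c
    using orthonormal_summable[OF E that] orthonormal_ultranorm_has_sum[OF E that] by metis
  show "\<exists>c\<in>C0 E. ((\<lambda>e. scale (c e) e) has_sum v) E" if "v \<in> closed_span E" for v
    using orthonormal_expansion[OF E that] by metis
qed

section \<open>Existence of orthonormal bases\<close>

text \<open>The distance condition on \<open>u\<close> gives \<open>\<bar>a\<bar> \<le> \<parallel>a u + y\<parallel>\<close> for \<open>y\<close> in the span of \<open>E\<close>, whence also
  \<open>\<parallel>y\<parallel> \<le> \<parallel>a u + y\<parallel>\<close> by the ultrametric inequality.\<close>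

lemma orthonormal_insert:
  assumes E: "orthonormal E" and u: "ultranorm u = 1"
    and far: "\<And>x. x \<in> span E \<Longrightarrow> 1 \<le> ultranorm (u - x)"
  shows "orthonormal (insert u E)"
  unfolding orthonormal_def
proof (intro conjI ballI allI impI)
  show "ultranorm e = 1" if "e \<in> insert u E" for e
    using that u orthonormal_unit[OF E] by auto
next
  fix F a e
  assume F: "finite F" "F \<subseteq> insert u E" and e: "e \<in> F"
  show "ultranorm (a e) \<le> ultranorm (\<Sum>x\<in>F. scale (a x) x)"
  proof (cases "u \<in> F")
    case False
    with F have "F \<subseteq> E" by auto
    then show ?thesis using F(1) e by (intro orthonormal_coeff_le[OF E])
  next
    case True
    define G where "G = F - {u}"
    define y where "y = (\<Sum>x\<in>G. scale (a x) x)"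
    have G: "finite G" "G \<subseteq> E" using F unfolding G_def by auto
    have y: "y \<in> span E"
      unfolding y_def using G by (intro span_sum span_scale span_base) auto
    have sum: "(\<Sum>x\<in>F. scale (a x) x) = scale (a u) u + y"
      unfolding y_def G_def using F(1) True by (rule sum.remove)
    have au: "ultranorm (a u) \<le> ultranorm (scale (a u) u + y)"
    proof (cases "a u = 0")
      case True
      then show ?thesis by (simp add: ultranorm_nonneg)
    next
      case False
      let ?x = "scale (- inverse (a u)) y"
      have "scale (a u) (u - ?x) = scale (a u) u + y"
        using False by (simp add: scale_right_diff_distrib scale_right_distrib)
      then have "ultranorm (scale (a u) u + y) = ultranorm (a u) * ultranorm (u - ?x)"
        by (metis norm_scale)
      moreover have "1 \<le> ultranorm (u - ?x)" using y by (intro far span_scale)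
      ultimately show ?thesis
        using mult_left_mono[OF _ ultranorm_nonneg[of "a u"], of 1 "ultranorm (u - ?x)"] by simp
    qed
    have "ultranorm y \<le> max (ultranorm (scale (a u) u + y)) (ultranorm (scale (a u) u))"
      using ultranorm_diff_le_max[of "scale (a u) u + y" "scale (a u) u"] by simp
    also have "\<dots> = ultranorm (scale (a u) u + y)" using au u by (simp add: norm_scale)
    finally have yle: "ultranorm y \<le> ultranorm (scale (a u) u + y)" .
    show ?thesis
    proof (cases "e = u")
      case True
      then show ?thesis using au sum by simp
    next
      case False
      then have "ultranorm (a e) \<le> ultranorm y"
        unfolding y_def using e G by (intro orthonormal_coeff_le[OF E]) (auto simp: G_def)
      then show ?thesis using yle sum by simp
    qed
  qed
qed

text \<open>Orthonormality is a condition on finite subsets, so Zorn's lemma applies.\<close>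

lemma maximal_orthonormal_exists:
  obtains E where "orthonormal E" "E \<subseteq> W"
    "\<And>E'. orthonormal E' \<Longrightarrow> E' \<subseteq> W \<Longrightarrow> E \<subseteq> E' \<Longrightarrow> E' = E"
proof -
  let ?A = "{E. orthonormal E \<and> E \<subseteq> W}"
  have "\<exists>M\<in>?A. \<forall>X\<in>?A. M \<subseteq> X \<longrightarrow> X = M"
  proof (rule subset_Zorn_nonempty)
    have "orthonormal {}" by (simp add: orthonormal_def)
    then show "?A \<noteq> {}" by auto
    fix \<C> assume ne: "\<C> \<noteq> {}" and ch: "subset.chain ?A \<C>"
    then have sub: "\<And>E. E \<in> \<C> \<Longrightarrow> orthonormal E \<and> E \<subseteq> W" by (auto simp: subset.chain_def)
    have "orthonormal (\<Union>\<C>)"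
      unfolding orthonormal_def
    proof (intro conjI ballI allI impI)
      show "ultranorm e = 1" if "e \<in> \<Union>\<C>" for e using that sub orthonormal_unit by blast
      fix F a e assume F: "finite F" "F \<subseteq> \<Union>\<C>" "e \<in> F"
      obtain E where E: "E \<in> \<C>" "F \<subseteq> E"
        using finite_subset_Union_chain[OF F(1,2) ne ch] by blast
      then show "ultranorm (a e) \<le> ultranorm (\<Sum>x\<in>F. scale (a x) x)"
        using sub F by (intro orthonormal_coeff_le[of E]) auto
    qed
    then show "\<Union>\<C> \<in> ?A" using sub by blast
  qed
  then show thesis using that by auto
qed

lemma closed_span_minimal:
  assumes "subspace W" "closed W" "S \<subseteq> W"
  shows "closed_span S \<subseteq> W"
  unfolding closed_span_def using assms by (intro closure_minimal span_minimal)

lemma subspace_closed_span: "subspace (closed_span S)"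
proof (rule subspaceI)
  show "0 \<in> closed_span S"
    unfolding closed_span_def using span_zero closure_subset by blast
next
  fix x y assume "x \<in> closed_span S" "y \<in> closed_span S"
  then obtain f g where f: "\<And>n. f n \<in> span S" "f \<longlonglongrightarrow> x" and g: "\<And>n. g n \<in> span S" "g \<longlonglongrightarrow> y"
    unfolding closed_span_def closure_sequential by blast
  have "(\<lambda>n. f n + g n) \<longlonglongrightarrow> x + y" using f(2) g(2) by (rule tendsto_add)
  then show "x + y \<in> closed_span S"
    unfolding closed_span_def closure_sequential using span_add[OF f(1) g(1)]
    by (intro exI[of _ "\<lambda>n. f n + g n"]) auto
next
  fix c :: 'k and x assume "x \<in> closed_span S"
  then obtain f where f: "\<And>n. f n \<in> span S" "f \<longlonglongrightarrow> x"
    unfolding closed_span_def closure_sequential by blast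
  have "(\<lambda>n. ultranorm c * dist (f n) x) \<longlonglongrightarrow> 0"
    using f(2) by (intro tendsto_mult_right_zero tendsto_dist_iff[THEN iffD1])
  moreover have "dist (scale c (f n)) (scale c x) = ultranorm c * dist (f n) x" for n
    by (simp add: dist_ultranorm norm_scale flip: scale_right_diff_distrib)
  ultimately have "(\<lambda>n. scale c (f n)) \<longlonglongrightarrow> scale c x"
    by (subst tendsto_dist_iff) simp
  then show "scale c x \<in> closed_span S"
    unfolding closed_span_def closure_sequential using span_scale[OF f(1)]
    by (intro exI[of _ "\<lambda>n. scale c (f n)"]) auto
qed

text \<open>Discreteness is used in the form that any bounded interval away from \<open>0\<close> contains only finitely
  many valuations.\<close>

theorem free_if_norms_in_valuations:
  assumes W: "subspace W" "closed W"
    and norms: "ultranorm ` W \<subseteq> range (ultranorm :: 'k \<Rightarrow> real)"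
    and discrete: "\<And>\<delta> M. 0 < \<delta> \<Longrightarrow> finite (range (ultranorm :: 'k \<Rightarrow> real) \<inter> {\<delta>..M})"
  shows "free W"
proof -
  obtain E where E: "orthonormal E" "E \<subseteq> W"
    and max: "\<And>E'. orthonormal E' \<Longrightarrow> E' \<subseteq> W \<Longrightarrow> E \<subseteq> E' \<Longrightarrow> E' = E"
    using maximal_orthonormal_exists by blast
  have spanW: "span E \<subseteq> W" using E(2) W(1) by (rule span_minimal)
  have "v \<in> closed_span E" if v: "v \<in> W" for v
  proof (rule ccontr)
    assume "v \<notin> closed_span E"
    then obtain \<delta> where \<delta>: "0 < \<delta>" "\<And>d. d \<in> span E \<Longrightarrow> \<delta> \<le> ultranorm (v - d)"
      unfolding closed_span_def closure_approachable dist_ultranorm[symmetric]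
      by (metis dist_commute linorder_not_le)
    \<comment> \<open>The finite set of distances from \<open>v\<close> to the span that do not exceed the distance to \<open>0\<close>.\<close>
    let ?A = "(\<lambda>d. ultranorm (v - d)) ` span E \<inter> {\<delta>..ultranorm v}"
    have "?A \<subseteq> range (ultranorm :: 'k \<Rightarrow> real) \<inter> {\<delta>..ultranorm v}"
      using norms v spanW subspace_diff[OF W(1)] by blast
    then have fin: "finite ?A" using discrete[OF \<delta>(1)] by (rule finite_subset)
    have vA: "ultranorm v \<in> ?A"
      using \<delta>(2)[OF span_zero] by (auto intro!: image_eqI[of _ _ 0] span_zero)
    then have "Min ?A \<in> ?A" using fin by (intro Min_in) auto
    then obtain d where d: "d \<in> span E" "ultranorm (v - d) = Min ?A" by auto
    have least: "ultranorm (v - d) \<le> ultranorm (v - x)" if "x \<in> span E" for x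
    proof (cases "ultranorm (v - x) \<le> ultranorm v")
      case True
      then show ?thesis unfolding d(2) using that \<delta>(2) fin by (intro Min_le) auto
    next
      case False
      moreover have "Min ?A \<le> ultranorm v" using fin vA by (rule Min_le)
      ultimately show ?thesis using d(2) by simp
    qed
    have vdW: "v - d \<in> W" using v d(1) spanW by (intro subspace_diff[OF W(1)]) auto
    then obtain b :: 'k where b: "ultranorm (v - d) = ultranorm b" using norms by blast
    have bpos: "0 < ultranorm b" using \<delta> d(1) b by force
    then have b0: "b \<noteq> 0" by auto
    define u where "u = scale (inverse b) (v - d)"
    have u1: "ultranorm u = 1"
      unfolding u_def using bpos by (simp add: norm_scale ultranorm_inverse b)
    have far: "1 \<le> ultranorm (u - x)" if "x \<in> span E" for x
    proof -
      have "u - x = scale (inverse b) (v - (d + scale b x))"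
        unfolding u_def using b0 by (simp add: scale_right_diff_distrib scale_right_distrib)
      then have "ultranorm (u - x) = ultranorm (v - (d + scale b x)) / ultranorm b"
        by (simp add: norm_scale ultranorm_inverse divide_inverse mult.commute)
      moreover have "ultranorm b \<le> ultranorm (v - (d + scale b x))"
        unfolding b[symmetric] using d(1) that by (intro least span_add span_scale)
      ultimately show ?thesis using bpos by (simp add: pos_le_divide_eq)
    qed
    have "u \<in> W" unfolding u_def using W(1) vdW by (rule subspace_scale)
    then have "u \<in> E"
      using max[OF orthonormal_insert[OF E(1) u1 far]] E(2) by auto
    \<comment> \<open>Taking \<open>x = u\<close> in the distance bound gives \<open>1 \<le> 0\<close>.\<close>
    then show False using far[OF span_base] by fastforce
  qed
  then have "closed_span E = W" using closed_span_minimal[OF W E(2)] by blast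
  then show ?thesis
    using orthonormal_imp_schauder_basis[OF E(1)] unfolding free_def by blast
qed

section \<open>Norms on free and almost free spaces\<close>

lemma free_norms_in_valuations:
  assumes "free W" "v \<in> W"
  shows "ultranorm v \<in> range (ultranorm :: 'k \<Rightarrow> real)"
proof -
  obtain E where E: "orthonormal_schauder_basis W E"
    using assms(1) unfolding free_def by blast
  then obtain c where c: "c \<in> C0 E" "((\<lambda>e. scale (c e) e) has_sum v) E"
    using assms(2) unfolding orthonormal_schauder_basis_def by blast
  with E obtain s where "((\<lambda>e. scale (c e) e) has_sum s) E" "ultranorm s = C0_norm E c"
    unfolding orthonormal_schauder_basis_def by blast
  with c(2) have "ultranorm v = C0_norm E c" using has_sum_unique by blast
  then show ?thesis using C0_norm_in_range_valuation[OF c(1)] by simp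
qed

lemma closed_line:
  "closed (range (\<lambda>a. scale a w))"
proof (cases "w = 0")
  case False
  then have w: "0 < ultranorm w"
    using ultranorm_nonneg[of w] by (simp add: less_le flip: ultranorm_eq_0_iff)
  have dist_line: "dist (scale a w) (scale b w) = dist a b * ultranorm w" for a b
    by (simp add: dist_ultranorm norm_scale flip: scale_left_diff_distrib)
  have "complete (range (\<lambda>a. scale a w))"
    unfolding complete_def
  proof (intro allI impI, elim conjE)
    fix x assume "\<forall>n. x n \<in> range (\<lambda>a. scale a w)" and C: "Cauchy x"
    then have "\<forall>n. \<exists>a. x n = scale a w" by blast
    then obtain a where a: "\<And>n. x n = scale (a n) w" by (auto dest!: choice)
    have "Cauchy a"
    proof (rule metric_CauchyI)
      fix \<epsilon> :: real assume "0 < \<epsilon>"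
      then have "0 < \<epsilon> * ultranorm w" using w by simp
      from metric_CauchyD[OF C this] show "\<exists>M. \<forall>m\<ge>M. \<forall>n\<ge>M. dist (a m) (a n) < \<epsilon>"
        using w by (simp add: a dist_line)
    qed
    then obtain l where l: "a \<longlonglongrightarrow> l" by (metis Cauchy_convergent convergent_def)
    then have "(\<lambda>n. dist (a n) l * ultranorm w) \<longlonglongrightarrow> 0"
      by (intro tendsto_mult_left_zero tendsto_dist_iff[THEN iffD1])
    then have "x \<longlonglongrightarrow> scale l w"
      by (subst tendsto_dist_iff) (simp add: a dist_line)
    then show "\<exists>l\<in>range (\<lambda>a. scale a w). x \<longlonglongrightarrow> l" by blast
  qed
  then show ?thesis by (rule complete_imp_closed)
qed simp

text \<open>If the rank exceeds \<open>1\<close>, then the line through any vector \<open>v \<noteq> 0\<close> is free. Otherwise \<open>V\<close> is zero or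
  a line, and the isometry with the scalars applies in the latter case.\<close>

lemma almost_free_norms_in_valuations:
  assumes af: almost_free
    and iso: "dim UNIV = 1 \<Longrightarrow> range (ultranorm :: 'v \<Rightarrow> real) \<subseteq> range (ultranorm :: 'k \<Rightarrow> real)"
  shows "ultranorm (v::'v) \<in> range (ultranorm :: 'k \<Rightarrow> real)"
proof (cases "v = 0")
  case True
  then show ?thesis using rangeI[of ultranorm "0::'k"] by simp
next
  case False
  obtain S where S: "rank = |S|" "closed_span S = UNIV"
    using rank_attained by metis
  show ?thesis
  proof (cases "|{v}| <o rank")
    case True
    then have "free (closed_span {v})" using af unfolding almost_free_def kappa_free_def by blast
    moreover have "v \<in> closed_span {v}"
      unfolding closed_span_def using span_base closure_subset by blast
    ultimately show ?thesis by (rule free_norms_in_valuations)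
  next
    case False
    then have "|S| \<le>o |{v}|"
      unfolding S(1) by (simp add: not_ordLess_iff_ordLeq card_of_Well_order)
    then obtain g where g: "inj_on g S" "g ` S \<subseteq> {v}" using card_of_ordLeq[of S "{v}"] by blast
    \<comment> \<open>So \<open>S\<close> has at most one element.\<close>
    have "x = y" if "x \<in> S" "y \<in> S" for x y
    proof -
      have "g x = g y" using g(2) that by blast
      then show ?thesis using g(1) that by (simp add: inj_on_eq_iff)
    qed
    then have "\<exists>w. S \<subseteq> {w}" by (cases "S = {}") blast+
    then obtain w where w: "S \<subseteq> {w}" ..
    then have "closed_span S \<subseteq> closed_span {w}"
      unfolding closed_span_def by (intro closure_mono span_mono)
    moreover have "closed_span {w} = span {w}"
      unfolding closed_span_def using closed_line[of w] by (simp add: span_singleton closure_closed)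
    ultimately have line: "span {w} = UNIV" using S(2) by auto
    have "w \<noteq> 0"
    proof
      assume "w = 0"
      then have "UNIV = {0 :: 'v}" using line by simp
      then show False using \<open>v \<noteq> 0\<close> by blast
    qed
    then have "dim (span {w}) = 1" by (simp add: dim_eq_card_independent)
    then have "dim UNIV = 1" unfolding line .
    then show ?thesis using iso by blast
  qed
qed

lemma isometry_if_dim_1:
  assumes dim: "dim UNIV = 1"
    and norms: "range (ultranorm :: 'v \<Rightarrow> real) \<subseteq> range (ultranorm :: 'k \<Rightarrow> real)"
  shows "\<exists>f. Vector_Spaces.linear (*) scale f \<and> bij f \<and> (\<forall>c. ultranorm (f c) = ultranorm c)"
proof -
  obtain B where B: "independent B" "UNIV \<subseteq> span B" "card B = 1"
    using basis_exists[of UNIV] dim by metis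
  then obtain w where w: "B = {w}" by (auto simp: card_1_singleton_iff)
  have w0: "w \<noteq> 0" using B(1) w by auto
  obtain b :: 'k where b: "ultranorm w = ultranorm b" using norms by blast
  have b0: "b \<noteq> 0" using b w0 by (metis ultranorm_eq_0_iff)
  define u where "u = scale (inverse b) w"
  have u: "ultranorm u = 1"
    using b0 by (simp add: u_def norm_scale b ultranorm_inverse ultranorm_eq_0_iff)
  then have u0: "u \<noteq> 0" by auto
  let ?f = "\<lambda>c. scale c u"
  have "Vector_Spaces.linear (*) scale ?f"
    by unfold_locales (auto simp: scale_left_distrib algebra_simps)
  moreover have "bij ?f"
  proof (rule bijI)
    show "inj ?f" using u0 by (auto intro: injI)
    show "surj ?f"
      unfolding surj_def
    proof
      fix v
      have "v \<in> span {w}" using B(2) w by blast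
      then obtain a where "v = scale a w" unfolding span_singleton by blast
      then have "v = scale (a * b) u" using b0 by (simp add: u_def)
      then show "\<exists>c. v = scale c u" by blast
    qed
  qed
  moreover have "\<forall>c. ultranorm (?f c) = ultranorm c" by (simp add: norm_scale u)
  ultimately show ?thesis by blast
qed

end

section \<open>The characterization of free spaces\<close>

theorem proposition4p3:
  fixes scale :: "'k::local_field \<Rightarrow> 'v::ultrametric_banach_group \<Rightarrow> 'v"
  assumes "banach_vector_space scale"
  shows "(banach_vector_space.free scale UNIV \<longleftrightarrow>
            banach_vector_space.almost_free scale \<and>
            (vector_space.dim scale UNIV = 1 \<longrightarrow>
              (\<exists>f. Vector_Spaces.linear (*) scale f \<and> bij f \<and> (\<forall>c. ultranorm (f c) = ultranorm c)))) \<and>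
         (banach_vector_space.free scale UNIV \<longleftrightarrow>
            range (ultranorm :: 'v \<Rightarrow> real) \<subseteq> range (ultranorm :: 'k \<Rightarrow> real))"
proof -
  interpret banach_vector_space scale by (rule assms)
  let ?iso = "\<exists>f. Vector_Spaces.linear (*) scale f \<and> bij f \<and> (\<forall>c. ultranorm (f c) = ultranorm c)"
  let ?norms = "range (ultranorm :: 'v \<Rightarrow> real) \<subseteq> range (ultranorm :: 'k \<Rightarrow> real)"
  have free_subspace: "free W" if "?norms" "subspace W" "closed W" for W
    using that finite_valuations_between by (intro free_if_norms_in_valuations) auto
  have closed_span: "subspace (closed_span S)" "closed (closed_span S)" for S
    using subspace_closed_span by (auto simp: closed_span_def)
  have norms_if_free: "?norms" if "free UNIV"
    using free_norms_in_valuations[OF that] by blast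
  have free_if_norms: "free UNIV" if "?norms"
    using free_subspace[OF that] by simp
  have almost_free_if_norms: "almost_free \<and> (dim UNIV = 1 \<longrightarrow> ?iso)" if "?norms"
    using free_subspace[OF that] closed_span isometry_if_dim_1[OF _ that]
    unfolding almost_free_def kappa_free_def by blast
  have norms_if_almost_free: "?norms" if "almost_free" "dim UNIV = 1 \<longrightarrow> ?iso"
  proof -
    have "?norms" if iso: ?iso
    proof -
      obtain f :: "'k \<Rightarrow> 'v" where "surj f" "\<And>c. ultranorm (f c) = ultranorm c"
        using iso by (auto simp: bij_def)
      then show ?thesis by (metis image_subsetI rangeI surj_def)
    qed
    then show ?thesis using almost_free_norms_in_valuations that by blast
  qed
  show ?thesis using norms_if_free free_if_norms almost_free_if_norms norms_if_almost_free by blast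
qed

end
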